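(* The separated condition $\tau L<2$, $\tau\eta\|A\|^2<\frac43$ does not guarantee convergence of PDDY/AFBA or of PD3O for the general three-function problem $\min_x f(x)+g(x)+h(Ax)$. Precisely, in $\mathbb{R}^2$ let $$\mathcal{P}:=\{x:x_1=x_2/3\},\qquad \mathcal{Q}:=\{x:x_1=x_2\},$$ $$A=I_2,\quad f(x)=\tfrac12x_1^2,\quad g=\iota_{\mathcal{Q}},\quad h^*=\iota_{\mathcal{P}}\ (\text{so } h=\iota_{\mathcal{P}^\perp}),\quad \tau=\tfrac{39}{20},\quad \eta=\tfrac23.$$ Then $\nabla f$ is Lipschitz with constant $L=1$, $\|A\|^2=1$, $\tau L/2=\frac{39}{40}<1$, $\tau\eta\|A\|^2=\frac{13}{10}<\frac43$, $x^*=0$ is the unique primal solution, $(x^*,s^* )=(0,0)$ is a saddle point, and the following hold. (a) After one iteration, the PDDY/AFBA iterates satisfy $s^k=\xi_k(1,3)^\top\in\mathcal{P}$ and $y^k=\zeta_k(1,1)^\top\in\mathcal{Q}$ with $$\binom{\xi_{k+1}}{\zeta_{k+1}}=M_{\mathrm{PDDY}}\binom{\xi_k}{\zeta_k},\qquad M_{\mathrm{PDDY}}=\begin{pmatrix}1&4/15\\-3.9&-1.548\end{pmatrix}.$$ The matrix $M_{\mathrm{PDDY}}$ has a real eigenvalue smaller than $-1$, and the PDDY/AFBA iteration diverges for any initialization with a nonzero component in the corresponding unstable eigendirection. (b) After one iteration, the PD3O iterates satisfy $s^k=\xi_k(1,3)^\top\in\mathcal{P}$, and $w^k:=(\xi_k,z_1^k,z_2^k)^\top$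 satisfies $w^{k+1}=M_{\mathrm{PD3O}}w^k$ with $$M_{\mathrm{PD3O}}=\begin{pmatrix}-0.3&0.135&1/600\\0.585&-0.73825&-0.47825\\1.755&-0.28975&0.49025\end{pmatrix}.$$ The matrix $M_{\mathrm{PD3O}}$ has a real eigenvalue smaller than $-1$, and the PD3O iteration diverges for suitable initializations.
   Context: $\iota_C$ is the indicator function of $C$ ($0$ on $C$, $+\infty$ elsewhere), $P_C$ is the orthogonal projection onto $C$, $h^*$ is the convex conjugate of $h$, $\|A\|$ is the spectral norm, and $L$ is a Lipschitz constant of $\nabla f$. The saddle function is $\mathcal{L}(x,s)=f(x)+g(x)+\langle Ax,s\rangle-h^*(s)$. For the example, the iterations ($k\ge0$) with primal stepsize $\tau$ and dual stepsize $\eta$ are: PDDY/AFBA: $$s^{k+1}=P_{\mathcal{P}}(s^k+\eta y^k),\quad x^{k+1}=y^k-\tau(s^{k+1}-s^k),\quad y^{k+1}=P_{\mathcal{Q}}\bigl(x^{k+1}-\tau s^{k+1}-\tau\nabla f(x^{k+1})\bigr).$$ PD3O: $$x^k=P_{\mathcal{Q}}z^k,\quad s^{k+1}=P_{\mathcal{P}}\bigl((1-\tau\eta)s^k+\eta(2x^k-z^k-\tau\nabla f(x^k))\bigr),\quad z^{k+1}=x^k-\tau\nabla f(x^k)-\tau s^{k+1}.$$ "Diverges" means that the sequence of iterates does not converge. "After one iteration" means for all $k\ge1$. In (a), "component in the unstable eigendirection" refers to the component of $(\xi_1,\zeta_1)^\top$ along the eigenvector for the eigenvalue smaller than $-1$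 in its expansion in the eigenbasis of $M_{\mathrm{PDDY}}$. *)

theory Defs
  imports "HOL-Analysis.Analysis"
begin

definition indicator_fun :: "'a set \<Rightarrow> 'a \<Rightarrow> ereal" where
  "indicator_fun C x = (if x \<in> C then 0 else \<infinity>)"

definition conjugate :: "('a::real_inner \<Rightarrow> ereal) \<Rightarrow> 'a \<Rightarrow> ereal" where
  "conjugate h s = (SUP x. ereal (x \<bullet> s) - h x)"

definition grad :: "('a::real_inner \<Rightarrow> real) \<Rightarrow> 'a \<Rightarrow> 'a" where
  "grad f x = (THE D. GDERIV f x :> D)"

definition closed_proper_convex :: "('a::real_normed_vector \<Rightarrow> ereal) \<Rightarrow> bool" where
  "closed_proper_convex g \<longleftrightarrow>
     convex {(x, r::real). g x \<le> ereal r} \<and> closed {(x, r::real). g x \<le> ereal r} \<and>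
     (\<forall>x. g x \<noteq> -\<infinity>) \<and> (\<exists>x. g x \<noteq> \<infinity>)"

definition prox :: "real \<Rightarrow> ('a::real_inner \<Rightarrow> ereal) \<Rightarrow> 'a \<Rightarrow> 'a" where
  "prox \<gamma> g v = (ARG_MIN (\<lambda>u. g u + ereal ((norm (u - v))\<^sup>2 / (2 * \<gamma>))) u. True)"

(* The spectral norm: operator norm with respect to the Euclidean norms. *)
definition spectral_norm :: "real^'n^'m \<Rightarrow> real" where
  "spectral_norm A = onorm ((*v) A)"

definition primal_solution ::
  "(real^'n \<Rightarrow> real) \<Rightarrow> (real^'n \<Rightarrow> ereal) \<Rightarrow> (real^'m \<Rightarrow> ereal) \<Rightarrow> real^'n^'m \<Rightarrow> real^'n \<Rightarrow> bool" where
  "primal_solution f g h A x \<longleftrightarrow> is_arg_min (\<lambda>u. ereal (f u) + g u + h (A *v u)) (\<lambda>_. True) x"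

(* The indeterminate case \<infinity> - \<infinity> takes the value \<infinity> here; for proper g and h* it occurs
   only off dom g, and it does not affect which points are saddle points. *)
definition saddle_fun ::
  "(real^'n \<Rightarrow> real) \<Rightarrow> (real^'n \<Rightarrow> ereal) \<Rightarrow> (real^'m \<Rightarrow> ereal) \<Rightarrow> real^'n^'m
    \<Rightarrow> real^'n \<Rightarrow> real^'m \<Rightarrow> ereal" where
  "saddle_fun f g h A x s = ereal (f x) + g x + ereal ((A *v x) \<bullet> s) - conjugate h s"

definition saddle_point ::
  "(real^'n \<Rightarrow> real) \<Rightarrow> (real^'n \<Rightarrow> ereal) \<Rightarrow> (real^'m \<Rightarrow> ereal) \<Rightarrow> real^'n^'m
    \<Rightarrow> real^'n \<Rightarrow> real^'m \<Rightarrow> bool" where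
  "saddle_point f g h A x\<^sub>0 s\<^sub>0 \<longleftrightarrow>
     (\<forall>s. saddle_fun f g h A x\<^sub>0 s \<le> saddle_fun f g h A x\<^sub>0 s\<^sub>0) \<and>
     (\<forall>x. saddle_fun f g h A x\<^sub>0 s\<^sub>0 \<le> saddle_fun f g h A x s\<^sub>0)"

definition three_function_problem ::
  "(real^'n \<Rightarrow> real) \<Rightarrow> (real^'n \<Rightarrow> ereal) \<Rightarrow> (real^'m \<Rightarrow> ereal) \<Rightarrow> real^'n^'m \<Rightarrow> real \<Rightarrow> bool" where
  "three_function_problem f g h A L \<longleftrightarrow>
     convex_on UNIV f \<and> (\<forall>x. GDERIV f x :> grad f x) \<and> L-lipschitz_on UNIV (grad f) \<and>
     closed_proper_convex g \<and> closed_proper_convex h \<and>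
     (\<exists>x s. saddle_point f g h A x s)"

definition separated_condition :: "real^'n^'m \<Rightarrow> real \<Rightarrow> real \<Rightarrow> real \<Rightarrow> bool" where
  "separated_condition A L \<tau> \<eta> \<longleftrightarrow>
     \<tau> > 0 \<and> \<eta> > 0 \<and> \<tau> * L < 2 \<and> \<tau> * \<eta> * (spectral_norm A)\<^sup>2 < 4/3"

(* The initialization is (s 0, y 0); the value x 0 is unconstrained and not used. *)
definition PDDY_iterates ::
  "(real^'n \<Rightarrow> real) \<Rightarrow> (real^'n \<Rightarrow> ereal) \<Rightarrow> (real^'m \<Rightarrow> ereal) \<Rightarrow> real^'n^'m \<Rightarrow> real \<Rightarrow> real
    \<Rightarrow> (nat \<Rightarrow> real^'m) \<Rightarrow> (nat \<Rightarrow> real^'n) \<Rightarrow> (nat \<Rightarrow> real^'n) \<Rightarrow> bool" where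
  "PDDY_iterates f g h A \<tau> \<eta> s x y \<longleftrightarrow> (\<forall>k.
     s (k+1) = prox \<eta> (conjugate h) (s k + \<eta> *\<^sub>R (A *v y k)) \<and>
     x (k+1) = y k - \<tau> *\<^sub>R (transpose A *v (s (k+1) - s k)) \<and>
     y (k+1) = prox \<tau> g (x (k+1) - \<tau> *\<^sub>R (transpose A *v s (k+1)) - \<tau> *\<^sub>R grad f (x (k+1))))"

(* The initialization is (s 0, z 0). *)
definition PD3O_iterates ::
  "(real^'n \<Rightarrow> real) \<Rightarrow> (real^'n \<Rightarrow> ereal) \<Rightarrow> (real^'m \<Rightarrow> ereal) \<Rightarrow> real^'n^'m \<Rightarrow> real \<Rightarrow> real
    \<Rightarrow> (nat \<Rightarrow> real^'m) \<Rightarrow> (nat \<Rightarrow> real^'n) \<Rightarrow> (nat \<Rightarrow> real^'n) \<Rightarrow> bool" where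
  "PD3O_iterates f g h A \<tau> \<eta> s x z \<longleftrightarrow> (\<forall>k.
     x k = prox \<tau> g (z k) \<and>
     s (k+1) = prox \<eta> (conjugate h)
       (s k + \<eta> *\<^sub>R (A *v (2 *\<^sub>R x k - z k - \<tau> *\<^sub>R grad f (x k) - \<tau> *\<^sub>R (transpose A *v s k)))) \<and>
     z (k+1) = x k - \<tau> *\<^sub>R grad f (x k) - \<tau> *\<^sub>R (transpose A *v s (k+1)))"

definition eigenpair :: "real^'n^'n \<Rightarrow> real \<Rightarrow> real^'n \<Rightarrow> bool" where
  "eigenpair M l v \<longleftrightarrow> v \<noteq> 0 \<and> M *v v = l *\<^sub>R v"

definition eigenbasis :: "real^'n^'n \<Rightarrow> (real^'n) set \<Rightarrow> bool" where
  "eigenbasis M B \<longleftrightarrow> independent B \<and> span B = UNIV \<and> (\<forall>v\<in>B. \<exists>l. eigenpair M l v)"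


definition set_P :: "(real^2) set" where
  "set_P = {x. x$1 = x$2 / 3}"

definition set_Q :: "(real^2) set" where
  "set_Q = {x. x$1 = x$2}"

definition ex_A :: "real^2^2" where
  "ex_A = mat 1"

definition ex_f :: "real^2 \<Rightarrow> real" where
  "ex_f x = 1/2 * (x$1)\<^sup>2"

definition ex_g :: "real^2 \<Rightarrow> ereal" where
  "ex_g = indicator_fun set_Q"

definition ex_h :: "real^2 \<Rightarrow> ereal" where
  "ex_h = indicator_fun (set_P\<^sup>\<bottom>)"

definition ex_tau :: real where
  "ex_tau = 39/20"

definition ex_eta :: real where
  "ex_eta = 2/3"

definition ex_PDDY_iterates :: "(nat \<Rightarrow> real^2) \<Rightarrow> (nat \<Rightarrow> real^2) \<Rightarrow> (nat \<Rightarrow> real^2) \<Rightarrow> bool" where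
  "ex_PDDY_iterates s x y \<longleftrightarrow> (\<forall>k.
     s (k+1) = closest_point set_P (s k + ex_eta *\<^sub>R y k) \<and>
     x (k+1) = y k - ex_tau *\<^sub>R (s (k+1) - s k) \<and>
     y (k+1) = closest_point set_Q
       (x (k+1) - ex_tau *\<^sub>R s (k+1) - ex_tau *\<^sub>R grad ex_f (x (k+1))))"

definition ex_PD3O_iterates :: "(nat \<Rightarrow> real^2) \<Rightarrow> (nat \<Rightarrow> real^2) \<Rightarrow> (nat \<Rightarrow> real^2) \<Rightarrow> bool" where
  "ex_PD3O_iterates s x z \<longleftrightarrow> (\<forall>k.
     x k = closest_point set_Q (z k) \<and>
     s (k+1) = closest_point set_P
       ((1 - ex_tau * ex_eta) *\<^sub>R s k
         + ex_eta *\<^sub>R (2 *\<^sub>R x k - z k - ex_tau *\<^sub>R grad ex_f (x k))) \<and>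
     z (k+1) = x k - ex_tau *\<^sub>R grad ex_f (x k) - ex_tau *\<^sub>R s (k+1))"

definition M_PDDY :: "real^2^2" where
  "M_PDDY = vector [vector [1, 4/15],
                    vector [-3.9, -1.548]]"

definition M_PD3O :: "real^3^3" where
  "M_PD3O = vector [vector [-0.3, 0.135, 1/600],
                    vector [0.585, -0.73825, -0.47825],
                    vector [1.755, -0.28975, 0.49025]]"

end

theory Submission
  imports Defs
begin

text \<open>Both iterations of the example are eventually linear, because the two proximity operators are
  orthogonal projections onto lines and \<open>grad ex_f\<close> is linear. Their matrices have characteristic
  polynomials changing sign on \<open>[-2, -1]\<close>, hence an eigenvalue \<open>l < -1\<close>; the coordinate functional
  of the eigenvector is multiplied by \<open>l\<close> at each step, so it cannot converge unless it vanishes.\<close>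

section \<open>Subspaces, indicator functions and proximity operators\<close>

text \<open>By Pythagoras: \<open>v - z\<close> is the sum of the residual \<open>v - p\<close>,
  orthogonal to \<open>S\<close>, and of \<open>p - z\<close>, which lies in
  \<open>S\<close>.\<close>

lemma closest_point_subspace:
  fixes S :: "'a::euclidean_space set"
  assumes S: "subspace S" and p: "p \<in> S" and orth: "\<And>z. z \<in> S \<Longrightarrow> orthogonal (v - p) z"
  shows "closest_point S v = p"
proof (rule closest_point_unique[symmetric])
  show "\<forall>z\<in>S. dist v p \<le> dist v z"
  proof
    fix z assume "z \<in> S"
    then have "orthogonal (v - p) (p - z)"
      using orth S p by (simp add: subspace_diff)
    then have "(norm (v - z))\<^sup>2 = (norm (v - p))\<^sup>2 + (norm (p - z))\<^sup>2"
      using norm_add_Pythagorean[of "v - p" "p - z"] by simp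
    then have "(norm (v - p))\<^sup>2 \<le> (norm (v - z))\<^sup>2" by simp
    then show "dist v p \<le> dist v z"
      unfolding dist_norm by (rule power2_le_imp_le) simp
  qed
qed (use S p in \<open>auto simp: subspace_imp_convex closed_subspace\<close>)

text \<open>Off \<open>C\<close> the objective is infinite; on \<open>C\<close> it increases with
  the distance to \<open>v\<close>, for every positive stepsize.\<close>

lemma prox_indicator:
  fixes C :: "'a::euclidean_space set"
  assumes C: "convex C" "closed C" "C \<noteq> {}" and \<gamma>: "\<gamma> > 0"
  shows "prox \<gamma> (indicator_fun C) v = closest_point C v"
proof -
  let ?F = "\<lambda>u. indicator_fun C u + ereal ((norm (u - v))\<^sup>2 / (2 * \<gamma>))"
  have le: "(norm (a - v))\<^sup>2 / (2 * \<gamma>) \<le> (norm (b - v))\<^sup>2 / (2 * \<gamma>) \<longleftrightarrow> dist v a \<le> dist v b" for a b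
    using \<gamma> by (simp add: divide_le_cancel dist_norm norm_minus_commute)
  \<comment> \<open>\<open>arg_min\<close> is a choice operator, so the set of minimizers has to be
    shown to be exactly this singleton.\<close>
  have "is_arg_min ?F (\<lambda>_. True) u \<longleftrightarrow> u = closest_point C v" for u
  proof
    assume u: "is_arg_min ?F (\<lambda>_. True) u"
    have min: "?F u \<le> ?F w" for w
      using u by (auto simp: is_arg_min_def not_less)
    \<comment> \<open>The objective is finite at any point of \<open>C\<close>, which forces the
      minimizer into \<open>C\<close>.\<close>
    obtain c where c: "c \<in> C" using C by blast
    have uC: "u \<in> C"
      using min[of c] c by (auto simp: indicator_fun_def split: if_splits)
    have "\<forall>z\<in>C. dist v u \<le> dist v z"
    proof
      fix z assume "z \<in> C"
      then show "dist v u \<le> dist v z"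
        using min[of z] uC by (simp add: indicator_fun_def flip: le)
    qed
    then show "u = closest_point C v"
      using closest_point_unique C uC by blast
  next
    assume u: "u = closest_point C v"
    then have uC: "u \<in> C" using C closest_point_in_set by blast
    have "?F u \<le> ?F w" for w
    proof (cases "w \<in> C")
      case True
      then have "dist v u \<le> dist v w" using closest_point_le C u by blast
      then show ?thesis using True uC by (simp add: indicator_fun_def le)
    qed (simp add: indicator_fun_def)
    then show "is_arg_min ?F (\<lambda>_. True) u"
      by (auto simp: is_arg_min_def not_less)
  qed
  then have eq: "is_arg_min ?F (\<lambda>_. True) = (\<lambda>u. u = closest_point C v)" by blast
  show ?thesis
    unfolding prox_def arg_min_def eq by simp
qed

text \<open>A linear functional on a subspace is either zero or unbounded above, so the supremum is
  0 or infinite.\<close>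

lemma conjugate_indicator_subspace:
  fixes W :: "'a::real_inner set"
  assumes W: "subspace W"
  shows "conjugate (indicator_fun W) = indicator_fun (W\<^sup>\<bottom>)"
proof
  fix s :: 'a
  show "conjugate (indicator_fun W) s = indicator_fun (W\<^sup>\<bottom>) s"
  proof (cases "s \<in> W\<^sup>\<bottom>")
    case True
    then have "w \<bullet> s = 0" if "w \<in> W" for w
      using that by (simp add: orthogonal_comp_def orthogonal_def)
    then have "ereal (x \<bullet> s) - indicator_fun W x \<le> 0" for x
      by (simp add: indicator_fun_def)
    moreover have "ereal (0 \<bullet> s) - indicator_fun W 0 = 0"
      using W by (simp add: indicator_fun_def subspace_0)
    ultimately have "conjugate (indicator_fun W) s = 0"
      unfolding conjugate_def by (metis (no_types, lifting) SUP_eqI UNIV_I)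
    with True show ?thesis by (simp add: indicator_fun_def)
  next
    case False
    then obtain w where w: "w \<in> W" "w \<bullet> s \<noteq> 0"
      by (auto simp: orthogonal_comp_def orthogonal_def)
    have "conjugate (indicator_fun W) s = \<infinity>"
      unfolding conjugate_def
    proof (rule SUP_PInfty)
      fix n :: nat
      \<comment> \<open>Scaled so that its inner product with \<open>s\<close> is exactly
        \<open>n\<close>.\<close>
      let ?x = "(real n / (w \<bullet> s)) *\<^sub>R w"
      have "?x \<in> W" using W w by (simp add: subspace_scale)
      then have "ereal (real n) \<le> ereal (?x \<bullet> s) - indicator_fun W ?x"
        using w by (simp add: indicator_fun_def)
      then show "\<exists>x\<in>UNIV. ereal (real n) \<le> ereal (x \<bullet> s) - indicator_fun W x" by blast
    qed
    with False show ?thesis by (simp add: indicator_fun_def)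
  qed
qed

text \<open>The epigraph is the product of \<open>C\<close> with a closed half-line.\<close>

lemma closed_proper_convex_indicator:
  assumes "convex C" "closed C" "C \<noteq> {}"
  shows "closed_proper_convex (indicator_fun C)"
proof -
  have "{(x, r::real). indicator_fun C x \<le> ereal r} = C \<times> {0..}"
    by (auto simp: indicator_fun_def split: if_splits)
  then show ?thesis
    using assms unfolding closed_proper_convex_def
    by (auto simp: convex_Times closed_Times indicator_fun_def)
qed

text \<open>\<open>grad\<close> is a definite description, so uniqueness is needed: two gradients at
  \<open>x\<close> represent the same linear functional.\<close>

lemma grad_eqI:
  assumes "GDERIV f x :> D"
  shows "grad f x = D"
  unfolding grad_def
proof (rule the_equality)
  fix E assume "GDERIV f x :> E"
  then have "(\<lambda>h. h \<bullet> E) = (\<lambda>h. h \<bullet> D)"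
    using assms has_derivative_unique unfolding gderiv_def by blast
  then show "E = D" by (metis vector_eq_ldot)
qed (rule assms)

section \<open>Eigenvectors and divergence\<close>

lemma eigenpair_if_det_eq_0:
  fixes M :: "real^'n^'n"
  assumes "det (M - mat l) = 0"
  shows "\<exists>v. eigenpair M l v"
proof -
  obtain v where v: "v \<noteq> 0" "(M - mat l) *v v = 0"
    using assms invertible_det_nz invertible_left_inverse
      matrix_left_invertible_ker[of "M - mat l"] by blast
  have "mat l *v v = l *\<^sub>R v"
    by (simp add: vec_eq_iff matrix_vector_mult_def mat_def if_distribR if_distrib cong: if_cong)
  then have "M *v v = l *\<^sub>R v"
    using v(2) by (simp add: matrix_vector_mult_diff_rdistrib)
  with v(1) show ?thesis unfolding eigenpair_def by blast
qed

text \<open>A limit would be fixed under multiplication by \<open>l\<close>, hence 0, whereas the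
  terms never drop below \<open>\<bar>c\<bar>\<close> in absolute value.\<close>

lemma not_convergent_power_mult:
  fixes l c :: real
  assumes l: "l < -1" and c: "c \<noteq> 0"
  shows "\<not> convergent (\<lambda>k. l ^ k * c)"
proof
  assume "convergent (\<lambda>k. l ^ k * c)"
  then obtain L where L: "(\<lambda>k. l ^ k * c) \<longlonglongrightarrow> L" by (auto simp: convergent_def)
  then have "(\<lambda>k. l * (l ^ k * c)) \<longlonglongrightarrow> l * L" by (rule tendsto_mult_left)
  moreover have "(\<lambda>k. l * (l ^ k * c)) \<longlonglongrightarrow> L"
    using LIMSEQ_Suc[OF L] by (simp add: mult.assoc)
  ultimately have "l * L = L" using LIMSEQ_unique by blast
  then have "L = 0" using l by simp
  then have "(\<lambda>k. \<bar>l ^ k * c\<bar>) \<longlonglongrightarrow> 0" using L tendsto_rabs_zero by blast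
  moreover have "\<bar>c\<bar> \<le> \<bar>l ^ k * c\<bar>" for k
    using l one_le_power[of "\<bar>l\<bar>" k] by (simp add: abs_mult power_abs mult_le_cancel_right1)
  ultimately have "\<bar>c\<bar> \<le> 0" by (meson LIMSEQ_le_const)
  then show False using c by simp
qed

text \<open>Both sides are linear in \<open>u\<close>, so it suffices to compare them on the
  eigenvectors in \<open>B\<close>.\<close>

lemma representation_eigenbasis:
  fixes M :: "real^'n^'n"
  assumes B: "eigenbasis M B" and v: "v \<in> B" "eigenpair M l v"
  shows "representation B (M *v u) v = l * representation B u v"
proof -
  have ind: "independent B" and span: "span B = UNIV"
    using B by (auto simp: eigenbasis_def)
  let ?\<phi> = "\<lambda>u. representation B u v"
  have lin: "linear ?\<phi>"
    by (rule linearI) (use ind span in \<open>simp_all add: representation_add representation_scale\<close>)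
  have "?\<phi> (M *v b) = l * ?\<phi> b" if b: "b \<in> B" for b
  proof -
    obtain m where m: "eigenpair M m b" using B b by (auto simp: eigenbasis_def)
    have *: "?\<phi> (M *v b) = m * ?\<phi> b"
      using m linear_cmul[OF lin] by (simp add: eigenpair_def)
    have \<phi>b: "?\<phi> b = (if b = v then 1 else 0)"
      using representation_basis[OF ind b] by auto
    show ?thesis
    proof (cases "b = v")
      case True
      \<comment> \<open>The eigenvalue is determined by its eigenvector, which is nonzero.\<close>
      then have "m = l" using m v(2) by (simp add: eigenpair_def)
      with * show ?thesis by simp
    qed (use * \<phi>b in simp)
  qed
  moreover have "linear (\<lambda>u. ?\<phi> (M *v u))"
    using linear_compose[OF matrix_vector_mul_linear lin] by (simp add: o_def)
  moreover have "linear (\<lambda>u. l * ?\<phi> u)"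
    using linear_compose_scale_right[OF lin, of l] by simp
  ultimately show ?thesis
    using linear_eq_on_span[of "\<lambda>u. ?\<phi> (M *v u)" "\<lambda>u. l * ?\<phi> u" B u] span by auto
qed

lemma not_convergent_if_unstable_component:
  fixes M :: "real^'n^'n"
  assumes rec: "\<And>k. w (Suc k) = M *v w k"
    and B: "eigenbasis M B" and v: "v \<in> B" "eigenpair M l v"
    and l: "l < -1" and nz: "representation B (w 0) v \<noteq> 0"
  shows "\<not> convergent w"
proof
  let ?\<phi> = "\<lambda>u. representation B u v"
  assume "convergent w"
  then obtain a where a: "w \<longlonglongrightarrow> a" by (auto simp: convergent_def)
  have "linear ?\<phi>"
    by (rule linearI)
      (use B in \<open>simp_all add: eigenbasis_def representation_add representation_scale\<close>)
  \<comment> \<open>A linear functional in finite dimension is continuous, so a limit of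
    \<open>w\<close> would give a limit of the coordinate along \<open>v\<close>.\<close>
  then have "(\<lambda>k. ?\<phi> (w k)) \<longlonglongrightarrow> ?\<phi> a"
    using a linear_continuous_at linear_conv_bounded_linear isCont_tendsto_compose by blast
  then have "convergent (\<lambda>k. ?\<phi> (w k))" by (rule convergentI)
  moreover have "?\<phi> (w k) = l ^ k * ?\<phi> (w 0)" for k
    by (induction k) (simp_all add: rec representation_eigenbasis[OF B v])
  then have "(\<lambda>k. ?\<phi> (w k)) = (\<lambda>k. l ^ k * ?\<phi> (w 0))" by blast
  ultimately have "convergent (\<lambda>k. l ^ k * ?\<phi> (w 0))" by (rule subst[rotated])
  then show False using not_convergent_power_mult[OF l nz] by blast
qed

section \<open>The data of the example\<close>

lemma vec2_eq_iff: "(x :: real^2) = y \<longleftrightarrow> x $ 1 = y $ 1 \<and> x $ 2 = y $ 2"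
  by (simp add: vec_eq_iff forall_2)

lemma vec3_eq_iff: "(x :: real^3) = y \<longleftrightarrow> x $ 1 = y $ 1 \<and> x $ 2 = y $ 2 \<and> x $ 3 = y $ 3"
  by (simp add: vec_eq_iff forall_3)

lemma inner_vec2: "(x :: real^2) \<bullet> y = x $ 1 * y $ 1 + x $ 2 * y $ 2"
  by (simp add: inner_vec_def sum_2)

lemma subspace_set_P: "subspace set_P"
  by (auto simp: subspace_def set_P_def)

lemma subspace_set_Q: "subspace set_Q"
  by (auto simp: subspace_def set_Q_def)

lemmas closed_convex_subspace = subspace_imp_convex closed_subspace subspace_0

text \<open>\<open>set_P\<close> is spanned by (1, 3), of squared norm 10; likewise
  \<open>set_Q\<close> below is spanned by (1, 1), of squared norm 2.\<close>

lemma closest_point_set_P: "closest_point set_P v = ((v $ 1 + 3 * v $ 2) / 10) *\<^sub>R vector [1, 3]"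
proof (rule closest_point_subspace[OF subspace_set_P])
  fix z assume "z \<in> set_P"
  then have "z $ 2 = 3 * z $ 1" by (simp add: set_P_def)
  then show "orthogonal (v - ((v $ 1 + 3 * v $ 2) / 10) *\<^sub>R vector [1, 3]) z"
    by (simp add: orthogonal_def inner_vec2 field_simps)
qed (simp add: set_P_def)

lemma closest_point_set_Q: "closest_point set_Q v = ((v $ 1 + v $ 2) / 2) *\<^sub>R vector [1, 1]"
proof (rule closest_point_subspace[OF subspace_set_Q])
  fix z assume "z \<in> set_Q"
  then have "z $ 2 = z $ 1" by (simp add: set_Q_def)
  then show "orthogonal (v - ((v $ 1 + v $ 2) / 2) *\<^sub>R vector [1, 1]) z"
    by (simp add: orthogonal_def inner_vec2 field_simps)
qed (simp add: set_Q_def)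

text \<open>The conjugate is the indicator of the double orthogonal complement of
  \<open>set_P\<close>, which is \<open>set_P\<close> itself in finite dimension.\<close>

lemma conjugate_ex_h: "conjugate ex_h = indicator_fun set_P"
  unfolding ex_h_def
  by (simp add: conjugate_indicator_subspace subspace_orthogonal_comp
      orthogonal_comp_self subspace_set_P)

lemma GDERIV_ex_f: "GDERIV ex_f x :> vector [x $ 1, 0]"
proof -
  have d: "((\<lambda>x. x $ 1) has_derivative (\<lambda>h. h $ 1)) (at x)"
    by (rule bounded_linear_imp_has_derivative[OF bounded_linear_vec_nth])
  have "((\<lambda>x. 1/2 * (x $ 1)\<^sup>2) has_derivative (\<lambda>h. h \<bullet> vector [x $ 1, 0])) (at x)"
    by (auto intro!: derivative_eq_intros d simp: inner_vec2 fun_eq_iff)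
  then show ?thesis
    by (simp add: gderiv_def ex_f_def[abs_def])
qed

lemma grad_ex_f: "grad ex_f x = vector [x $ 1, 0]"
  by (rule grad_eqI) (rule GDERIV_ex_f)

lemma lipschitz_grad_ex_f: "1-lipschitz_on UNIV (grad ex_f)"
proof (rule lipschitz_onI)
  fix x y :: "real^2"
  \<comment> \<open>The gradient is the projection onto the first coordinate axis, hence
    nonexpansive in each coordinate.\<close>
  have "norm (grad ex_f x - grad ex_f y) \<le> norm (x - y)"
  proof (rule norm_le_componentwise_cart)
    fix i :: 2
    show "norm ((grad ex_f x - grad ex_f y) $ i) \<le> norm ((x - y) $ i)"
      using exhaust_2[of i] by (auto simp: grad_ex_f)
  qed
  then show "dist (grad ex_f x) (grad ex_f y) \<le> 1 * dist x y"
    by (simp add: dist_norm)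
qed simp

lemma convex_ex_f: "convex_on UNIV ex_f"
proof (rule convex_onI)
  fix t :: real and x y :: "real^2"
  assume t: "0 < t" "t < 1"
  \<comment> \<open>The convexity gap of the square function, in closed form.\<close>
  have "(1 - t) * (x$1)\<^sup>2 + t * (y$1)\<^sup>2 - ((1 - t) * x$1 + t * y$1)\<^sup>2
      = t * (1 - t) * (x$1 - y$1)\<^sup>2"
    by (simp add: power2_eq_square algebra_simps)
  moreover have "t * (1 - t) * (x$1 - y$1)\<^sup>2 \<ge> 0" using t by simp
  ultimately show "ex_f ((1 - t) *\<^sub>R x + t *\<^sub>R y) \<le> (1 - t) * ex_f x + t * ex_f y"
    by (simp add: ex_f_def)
qed simp

lemma spectral_norm_ex_A: "spectral_norm ex_A = 1"
proof -
  have "(*v) ex_A = (\<lambda>x. x)" by (simp add: ex_A_def fun_eq_iff)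
  then show ?thesis using onorm_id[where 'a = "real^2"] by (simp add: spectral_norm_def)
qed

text \<open>The two constraint lines \<open>set_Q\<close> and \<open>set_P\<^sup>\<bottom>\<close>
  meet only at the origin, so the objective is infinite everywhere else.\<close>

lemma primal_solution_ex: "primal_solution ex_f ex_g ex_h ex_A x \<longleftrightarrow> x = 0"
proof -
  let ?F = "\<lambda>u. ereal (ex_f u) + ex_g u + ex_h (ex_A *v u)"
  have F0: "?F 0 = 0"
    by (simp add: ex_f_def ex_g_def ex_h_def ex_A_def indicator_fun_def set_Q_def
        subspace_0 subspace_orthogonal_comp)
  have F: "?F u = \<infinity>" if "u \<noteq> 0" for u
  proof -
    have "u \<notin> set_Q \<or> u \<notin> set_P\<^sup>\<bottom>"
    proof (rule ccontr)
      assume "\<not> ?thesis"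
      \<comment> \<open>Testing orthogonality on the spanning vector (1, 3) of \<open>set_P\<close>
        yields two independent linear equations for \<open>u\<close>.\<close>
      then have "u $ 1 = u $ 2" "vector [1, 3] \<bullet> u = 0"
        by (auto simp: set_Q_def set_P_def orthogonal_comp_def orthogonal_def)
      then have "u = 0" by (simp add: vec2_eq_iff inner_vec2)
      with that show False by simp
    qed
    then show ?thesis
      by (auto simp: ex_g_def ex_h_def ex_A_def indicator_fun_def)
  qed
  have less: "?F 0 < ?F u" if "u \<noteq> 0" for u
    unfolding F0 F[OF that] by simp
  moreover have "\<not> ?F u < ?F 0" for u
    using less[of u] by (cases "u = 0") (simp, metis order.asym)
  ultimately show ?thesis
    unfolding primal_solution_def is_arg_min_def by blast
qed

text \<open>At \<open>x = 0\<close> the saddle function is minus the indicator of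
  \<open>set_P\<close>, at most 0; at \<open>s = 0\<close> it is \<open>ex_f + ex_g\<close>, at
  least 0. Both vanish at the origin.\<close>

lemma saddle_point_ex: "saddle_point ex_f ex_g ex_h ex_A 0 0"
  unfolding saddle_point_def saddle_fun_def conjugate_ex_h
  by (auto simp: ex_f_def ex_g_def indicator_fun_def set_P_def set_Q_def)

lemma three_function_problem_ex: "three_function_problem ex_f ex_g ex_h ex_A 1"
  unfolding three_function_problem_def
proof (intro conjI)
  show "closed_proper_convex ex_g"
    unfolding ex_g_def
    by (rule closed_proper_convex_indicator)
      (use subspace_set_Q in \<open>auto dest: closed_convex_subspace\<close>)
  show "closed_proper_convex ex_h"
    unfolding ex_h_def
    by (rule closed_proper_convex_indicator)
      (use subspace_orthogonal_comp[of set_P] in \<open>auto dest: closed_convex_subspace\<close>)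
qed (use convex_ex_f GDERIV_ex_f lipschitz_grad_ex_f saddle_point_ex in \<open>auto simp: grad_ex_f\<close>)

lemma separated_condition_ex: "separated_condition ex_A 1 ex_tau ex_eta"
  by (simp add: separated_condition_def spectral_norm_ex_A ex_tau_def ex_eta_def)

text \<open>Turns the general proximal iterations into the projected ones of the example.\<close>

lemma prox_ex:
  "prox ex_eta (conjugate ex_h) v = closest_point set_P v"
  "prox ex_tau ex_g v = closest_point set_Q v"
  unfolding conjugate_ex_h ex_g_def
  by (rule prox_indicator;
      use subspace_set_P subspace_set_Q in
        \<open>auto simp: ex_eta_def ex_tau_def dest: closed_convex_subspace\<close>)+

lemma PDDY_iterates_ex:
  "PDDY_iterates ex_f ex_g ex_h ex_A ex_tau ex_eta s x y \<longleftrightarrow> ex_PDDY_iterates s x y"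
  unfolding PDDY_iterates_def ex_PDDY_iterates_def prox_ex
  by (simp add: ex_A_def transpose_mat)

lemma PD3O_iterates_ex:
  "PD3O_iterates ex_f ex_g ex_h ex_A ex_tau ex_eta s x z \<longleftrightarrow> ex_PD3O_iterates s x z"
proof -
  \<comment> \<open>With the identity matrix, the dual correction contributes
    \<open>- ex_tau * ex_eta\<close> times \<open>s k\<close>, which merges with the leading
    \<open>s k\<close>.\<close>
  have "s k + ex_eta *\<^sub>R (ex_A *v (2 *\<^sub>R x k - z k - ex_tau *\<^sub>R grad ex_f (x k)
            - ex_tau *\<^sub>R (transpose ex_A *v s k)))
        = (1 - ex_tau * ex_eta) *\<^sub>R s k
            + ex_eta *\<^sub>R (2 *\<^sub>R x k - z k - ex_tau *\<^sub>R grad ex_f (x k))" for k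
    by (simp add: ex_A_def transpose_mat algebra_simps)
  then show ?thesis
    unfolding PD3O_iterates_def ex_PD3O_iterates_def prox_ex
    by (simp add: ex_A_def transpose_mat)
qed

section \<open>The PDDY/AFBA iteration\<close>

lemma M_PDDY_mult: "M_PDDY *v vector [a, b] = vector [a + 4/15 * b, -3.9 * a - 1.548 * b]"
  by (simp add: M_PDDY_def vec2_eq_iff matrix_vector_mult_def sum_2)

text \<open>The assumption is the characteristic equation: the trace is -0.548 and the determinant
  -0.508. The vector is chosen to satisfy the first row for every \<open>l\<close>; the second row
  is then this equation.\<close>

lemma eigenpair_M_PDDY:
  assumes "l\<^sup>2 + 0.548 * l - 0.508 = 0"
  shows "eigenpair M_PDDY l (vector [4/15, l - 1])"
proof -
  have "-3.9 * (4/15) - 1.548 * (l - 1) = l * (l - 1)"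
    using assms unfolding power2_eq_square power3_eq_cube right_diff_distrib by linarith
  then show ?thesis
    by (simp add: eigenpair_def M_PDDY_mult vec2_eq_iff diff_divide_distrib)
qed

lemma eigenvalue_PDDY: "\<exists>l < -1. l\<^sup>2 + 0.548 * l - 0.508 = (0::real)"
proof -
  let ?p = "\<lambda>l::real. l\<^sup>2 + 0.548 * l - 0.508"
  \<comment> \<open>The polynomial is 2.396 at -2 and -0.056 at -1.\<close>
  have "\<exists>l\<ge>-2. l \<le> -1 \<and> ?p l = 0"
    by (rule IVT2') (auto intro!: continuous_intros simp: power2_eq_square)
  then obtain l where l: "l \<le> -1" "?p l = 0" by blast
  moreover have "l \<noteq> -1" using l(2) by auto
  ultimately show ?thesis by (intro exI[of _ l]) auto
qed

text \<open>The characteristic polynomial has two distinct real roots, whose eigenvectors span the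
  plane. An expansion along the unstable direction therefore makes sense.\<close>

lemma eigenbasis_M_PDDY: "\<exists>B. eigenbasis M_PDDY B"
proof -
  obtain l where l: "l < -1" "l\<^sup>2 + 0.548 * l - 0.508 = (0::real)"
    using eigenvalue_PDDY by blast
  \<comment> \<open>The other root, by Vieta: the roots sum to -0.548.\<close>
  define m where "m = -0.548 - l"
  have m: "m\<^sup>2 + 0.548 * m - 0.508 = 0"
    using l(2) by (simp add: m_def power2_eq_square algebra_simps)
  have lm: "l \<noteq> m" using l(1) by (simp add: m_def)
  define a b :: "real^2" where "a = vector [4/15, l - 1]" and "b = vector [4/15, m - 1]"
  let ?B = "{a, b}"
  have span: "span ?B = UNIV"
  proof -
    have "u \<in> span ?B" for u
    proof -
      \<comment> \<open>Both eigenvectors have first coordinate 4/15, so the coefficients of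
        \<open>a\<close> and \<open>b\<close> sum to \<open>15/4 * u $ 1\<close>; the second
        coordinate then fixes the coefficient \<open>q\<close> of \<open>b\<close>.\<close>
      define q where "q = (u $ 2 - 15/4 * u $ 1 * (l - 1)) / (m - l)"
      then have "q * (m - l) = u $ 2 - 15/4 * u $ 1 * (l - 1)" using lm by simp
      then have "u $ 2 = (15/4 * u $ 1 - q) * (l - 1) + q * (m - 1)"
        by (simp only: ring_distribs)
      then have "u = (15/4 * u $ 1 - q) *\<^sub>R a + q *\<^sub>R b"
        by (simp add: vec2_eq_iff a_def b_def diff_divide_distrib)
      moreover have "(15/4 * u $ 1 - q) *\<^sub>R a + q *\<^sub>R b \<in> span ?B"
        by (intro span_add span_scale span_base) auto
      ultimately show ?thesis by simp
    qed
    then show ?thesis by blast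
  qed
  \<comment> \<open>A spanning set with at most as many elements as the dimension is
    independent.\<close>
  have "card ?B \<le> 2" by (simp add: card_insert_if)
  then have "independent ?B"
    by (intro card_le_dim_spanning[where V = UNIV]) (use span in \<open>auto simp: dim_UNIV\<close>)
  then have "eigenbasis M_PDDY ?B"
    using span eigenpair_M_PDDY[OF l(2)] eigenpair_M_PDDY[OF m]
    by (auto simp: eigenbasis_def a_def b_def)
  then show ?thesis by blast
qed

text \<open>Stated for single vectors rather than sequences, so that it serves both to analyse a
  given run and to verify a constructed one.\<close>

lemma PDDY_step:
  assumes s: "s = \<xi> *\<^sub>R vector [1, 3]" and y: "y = \<zeta> *\<^sub>R vector [1, 1]"
  defines "s' \<equiv> closest_point set_P (s + ex_eta *\<^sub>R y)"
  defines "x' \<equiv> y - ex_tau *\<^sub>R (s' - s)"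
  defines "y' \<equiv> closest_point set_Q (x' - ex_tau *\<^sub>R s' - ex_tau *\<^sub>R grad ex_f x')"
  shows "s' = (\<xi> + 4/15 * \<zeta>) *\<^sub>R vector [1, 3]"
    and "y' = (-3.9 * \<xi> - 1.548 * \<zeta>) *\<^sub>R vector [1, 1]"
proof -
  show s': "s' = (\<xi> + 4/15 * \<zeta>) *\<^sub>R vector [1, 3]"
    unfolding s'_def closest_point_set_P by (simp add: s y ex_eta_def vec2_eq_iff)
  show "y' = (-3.9 * \<xi> - 1.548 * \<zeta>) *\<^sub>R vector [1, 1]"
    unfolding y'_def x'_def closest_point_set_Q grad_ex_f s' s y
    by (simp add: ex_tau_def vec2_eq_iff field_simps)
qed

text \<open>The spanning vectors are normalized to first entry 1, which is why \<open>\<xi>\<close>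
  and \<open>\<zeta>\<close> can be read off as first coordinates.\<close>

lemma vec2_line: "v = c *\<^sub>R vector [1, d] \<Longrightarrow> v = v $ 1 *\<^sub>R (vector [1, d] :: real^2)"
  by simp

lemma PDDY_linear:
  assumes it: "ex_PDDY_iterates s x y"
  defines "\<xi> \<equiv> \<lambda>k. s k $ 1" and "\<zeta> \<equiv> \<lambda>k. y k $ 1"
  shows "\<forall>k\<ge>1. s k = \<xi> k *\<^sub>R vector [1, 3] \<and> s k \<in> set_P \<and>
                 y k = \<zeta> k *\<^sub>R vector [1, 1] \<and> y k \<in> set_Q \<and>
                 (vector [\<xi> (k+1), \<zeta> (k+1)] :: real^2) = M_PDDY *v vector [\<xi> k, \<zeta> k]"
proof (intro allI impI)
  fix k :: nat assume "k \<ge> 1"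
  then obtain j where j: "k = j + 1" by (metis le_add_diff_inverse2)
  \<comment> \<open>From index 1 on the iterates are outputs of projections and so lie on the lines;
    the initialization is arbitrary.\<close>
  have lines: "s k = \<xi> k *\<^sub>R vector [1, 3]" "y k = \<zeta> k *\<^sub>R vector [1, 1]"
    using it unfolding j ex_PDDY_iterates_def closest_point_set_P closest_point_set_Q \<xi>_def \<zeta>_def
    by (blast intro: vec2_line)+
  from PDDY_step[OF lines] it
  have "s (k+1) = (\<xi> k + 4/15 * \<zeta> k) *\<^sub>R vector [1, 3]"
    "y (k+1) = (-3.9 * \<xi> k - 1.548 * \<zeta> k) *\<^sub>R vector [1, 1]"
    unfolding ex_PDDY_iterates_def by metis+
  then have "(vector [\<xi> (k+1), \<zeta> (k+1)] :: real^2) = M_PDDY *v vector [\<xi> k, \<zeta> k]"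
    unfolding M_PDDY_mult by (simp add: \<xi>_def \<zeta>_def)
  moreover have "s k \<in> set_P" "y k \<in> set_Q"
    by (subst lines, simp add: set_P_def set_Q_def)+
  ultimately show "s k = \<xi> k *\<^sub>R vector [1, 3] \<and> s k \<in> set_P \<and>
                 y k = \<zeta> k *\<^sub>R vector [1, 1] \<and> y k \<in> set_Q \<and>
                 (vector [\<xi> (k+1), \<zeta> (k+1)] :: real^2) = M_PDDY *v vector [\<xi> k, \<zeta> k]"
    using lines by blast
qed

text \<open>Lets divergence of a triple be detected on one coordinate. For PD3O, \<open>z\<close>
  takes the place of \<open>y\<close>.\<close>

lemma convergent_components:
  fixes s x y :: "nat \<Rightarrow> real^2"
  assumes "convergent (\<lambda>k. (s k, x k, y k))"
  shows "convergent (\<lambda>k. s k $ i)" "convergent (\<lambda>k. y k $ i)"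
proof -
  obtain L where L: "(\<lambda>k. (s k, x k, y k)) \<longlonglongrightarrow> L"
    using assms by (auto simp: convergent_def)
  have "(\<lambda>k. s k $ i) \<longlonglongrightarrow> fst L $ i"
    using tendsto_vec_nth[OF tendsto_fst[OF L]] by simp
  moreover have "(\<lambda>k. y k $ i) \<longlonglongrightarrow> snd (snd L) $ i"
    using tendsto_vec_nth[OF tendsto_snd[OF tendsto_snd[OF L]]] by simp
  ultimately show "convergent (\<lambda>k. s k $ i)" "convergent (\<lambda>k. y k $ i)"
    by (auto simp: convergent_def)
qed

lemma PDDY_divergent:
  assumes it: "ex_PDDY_iterates s x y"
    and B: "eigenbasis M_PDDY B" and v: "v \<in> B" "eigenpair M_PDDY l v" and l: "l < -1"
    and nz: "representation B (vector [s 1 $ 1, y 1 $ 1]) v \<noteq> 0"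
  shows "\<not> convergent (\<lambda>k. (s k, x k, y k))"
proof
  assume conv: "convergent (\<lambda>k. (s k, x k, y k))"
  \<comment> \<open>Shifted by one: the linear recursion starts at index 1, so \<open>?w 0\<close>
    is the vector whose unstable component is assumed nonzero.\<close>
  let ?w = "\<lambda>k. vector [s (Suc k) $ 1, y (Suc k) $ 1] :: real^2"
  obtain a b where "(\<lambda>k. s k $ 1) \<longlonglongrightarrow> a" "(\<lambda>k. y k $ 1) \<longlonglongrightarrow> b"
    using convergent_components[OF conv, of 1] by (auto simp: convergent_def)
  then have lim: "(\<lambda>k. s (Suc k) $ 1) \<longlonglongrightarrow> a" "(\<lambda>k. y (Suc k) $ 1) \<longlonglongrightarrow> b"
    by (auto dest: LIMSEQ_Suc)
  have "?w \<longlonglongrightarrow> vector [a, b]"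
  proof (rule vec_tendstoI)
    fix i :: 2
    show "(\<lambda>k. ?w k $ i) \<longlonglongrightarrow> vector [a, b] $ i"
      using lim exhaust_2[of i] by auto
  qed
  then have "convergent ?w" by (auto simp: convergent_def)
  moreover have "?w (Suc k) = M_PDDY *v ?w k" for k
    using PDDY_linear[OF it] by simp
  ultimately show False
    using not_convergent_if_unstable_component[of ?w, OF _ B v l] nz by auto
qed

text \<open>Started on the unstable eigenvector, the state is multiplied by \<open>l\<close> at
  every step.\<close>

lemma ex_PDDY_divergent: "\<exists>s x y. ex_PDDY_iterates s x y \<and> \<not> convergent (\<lambda>k. (s k, x k, y k))"
proof -
  obtain l where l: "l < -1" "l\<^sup>2 + 0.548 * l - 0.508 = (0::real)"
    using eigenvalue_PDDY by blast
  define s y where "s = (\<lambda>k. (l ^ k * (4/15)) *\<^sub>R vector [1, 3] :: real^2)"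
    and "y = (\<lambda>k. (l ^ k * (l - 1)) *\<^sub>R vector [1, 1] :: real^2)"
  \<comment> \<open>Truncated subtraction gives \<open>x 0 = y 0\<close>; the recursion prescribes
    \<open>x\<close> only from index 1 on.\<close>
  define x where "x = (\<lambda>k. y (k - 1) - ex_tau *\<^sub>R (s k - s (k - 1)))"
  have p: "-3.9 * (4/15) - 1.548 * (l - 1) = l * (l - 1)"
    using l(2) unfolding power2_eq_square power3_eq_cube right_diff_distrib by linarith
  \<comment> \<open>\<open>e1\<close> and \<open>e2\<close> are the two rows of the eigenvector
    equation, scaled by \<open>l ^ k\<close>.\<close>
  have e1: "l ^ k * (4/15) + 4/15 * (l ^ k * (l - 1)) = l ^ (k+1) * (4/15)" for k
    by (simp add: algebra_simps diff_divide_distrib)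
  have e2: "-3.9 * (l ^ k * (4/15)) - 1.548 * (l ^ k * (l - 1)) = l ^ (k+1) * (l - 1)" for k
    using arg_cong[OF p, of "\<lambda>t. l ^ k * t"] by (simp add: algebra_simps)
  have "ex_PDDY_iterates s x y"
    unfolding ex_PDDY_iterates_def
  proof (intro allI conjI)
    fix k
    note step = PDDY_step[OF refl refl,
        where \<xi> = "l ^ k * (4/15)" and \<zeta> = "l ^ k * (l - 1)", unfolded e1 e2]
    show s': "s (k+1) = closest_point set_P (s k + ex_eta *\<^sub>R y k)"
      unfolding s_def y_def step(1) ..
    show x': "x (k+1) = y k - ex_tau *\<^sub>R (s (k+1) - s k)"
      by (simp add: x_def)
    show "y (k+1) = closest_point set_Q
        (x (k+1) - ex_tau *\<^sub>R s (k+1) - ex_tau *\<^sub>R grad ex_f (x (k+1)))"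
      unfolding x' s' unfolding s_def y_def step(2) ..
  qed
  moreover have "\<not> convergent (\<lambda>k. (s k, x k, y k))"
    using convergent_components(1)[of s x y 1] not_convergent_power_mult[OF l(1), of "4/15"]
    by (auto simp: s_def)
  ultimately show ?thesis by blast
qed

section \<open>The PD3O iteration\<close>

lemma M_PD3O_mult: "M_PD3O *v vector [a, b, c] = vector
    [-0.3 * a + 0.135 * b + 1/600 * c,
     0.585 * a - 0.73825 * b - 0.47825 * c,
     1.755 * a - 0.28975 * b + 0.49025 * c]"
  by (simp add: M_PD3O_def vec3_eq_iff matrix_vector_mult_def sum_3)

text \<open>Unlike for PDDY, no explicit eigenvector is given: a root of the characteristic
  polynomial makes the shifted matrix singular, and a kernel vector is taken.\<close>

lemma eigenpair_M_PD3O: "\<exists>l v. l < -1 \<and> eigenpair M_PD3O l v"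
proof -
  let ?p = "\<lambda>l. det (M_PD3O - mat l)"
  have p: "?p l = (-0.3 - l) * (-0.73825 - l) * (0.49025 - l)
      + 0.135 * (-0.47825) * 1.755 + 1/600 * 0.585 * (-0.28975)
      - (-0.3 - l) * (-0.47825) * (-0.28975) - 0.135 * 0.585 * (0.49025 - l)
      - 1/600 * (-0.73825 - l) * 1.755" for l
    by (simp add: det_3 M_PD3O_def mat_def)
  \<comment> \<open>The determinant is positive at -2 and negative at -1.\<close>
  have "\<exists>l\<ge>-2. l \<le> -1 \<and> ?p l = 0"
    unfolding p by (rule IVT2') (auto intro!: continuous_intros)
  then obtain l where l: "l \<le> -1" "?p l = 0" by blast
  moreover have "?p (-1) \<noteq> 0" unfolding p by simp
  ultimately have "l < -1" by (metis order_le_less)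
  with l(2) show ?thesis using eigenpair_if_det_eq_0 by blast
qed

text \<open>Only \<open>s\<close> is confined to a line; \<open>z\<close> is an arbitrary point of
  the plane, so the state has three coordinates.\<close>

lemma PD3O_step:
  fixes z :: "real^2"
  assumes s: "s = \<xi> *\<^sub>R vector [1, 3]"
  defines "x \<equiv> closest_point set_Q z"
  defines "s' \<equiv> closest_point set_P ((1 - ex_tau * ex_eta) *\<^sub>R s
         + ex_eta *\<^sub>R (2 *\<^sub>R x - z - ex_tau *\<^sub>R grad ex_f x))"
  defines "z' \<equiv> x - ex_tau *\<^sub>R grad ex_f x - ex_tau *\<^sub>R s'"
  defines "w \<equiv> M_PD3O *v vector [\<xi>, z $ 1, z $ 2]"
  shows "s' = (w $ 1) *\<^sub>R vector [1, 3]" "z' = vector [w $ 2, w $ 3]"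
proof -
  show s': "s' = (w $ 1) *\<^sub>R vector [1, 3]"
    unfolding s'_def x_def w_def M_PD3O_mult closest_point_set_P closest_point_set_Q grad_ex_f s
    by (simp add: ex_tau_def ex_eta_def vec2_eq_iff field_simps)
  show "z' = vector [w $ 2, w $ 3]"
    unfolding z'_def s' x_def w_def M_PD3O_mult closest_point_set_Q grad_ex_f
    by (simp add: ex_tau_def vec2_eq_iff field_simps)
qed

lemma PD3O_linear:
  assumes it: "ex_PD3O_iterates s x z"
  defines "\<xi> \<equiv> \<lambda>k. s k $ 1"
  shows "\<forall>k\<ge>1. s k = \<xi> k *\<^sub>R vector [1, 3] \<and> s k \<in> set_P \<and>
                (vector [\<xi> (k+1), z (k+1) $ 1, z (k+1) $ 2] :: real^3)
                  = M_PD3O *v vector [\<xi> k, z k $ 1, z k $ 2]"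
proof (intro allI impI)
  fix k :: nat assume "k \<ge> 1"
  then obtain j where j: "k = j + 1" by (metis le_add_diff_inverse2)
  \<comment> \<open>As for PDDY, \<open>s k\<close> is a projection onto \<open>set_P\<close> once
    \<open>k\<close> is at least 1.\<close>
  have line: "s k = \<xi> k *\<^sub>R vector [1, 3]"
    using it unfolding j ex_PD3O_iterates_def closest_point_set_P \<xi>_def
    by (blast intro: vec2_line)
  from PD3O_step[OF line, of "z k"] it
  have "s (k+1) = ((M_PD3O *v vector [\<xi> k, z k $ 1, z k $ 2]) $ 1) *\<^sub>R vector [1, 3]"
    "z (k+1) = vector [(M_PD3O *v vector [\<xi> k, z k $ 1, z k $ 2]) $ 2,
        (M_PD3O *v vector [\<xi> k, z k $ 1, z k $ 2]) $ 3]"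
    unfolding ex_PD3O_iterates_def by metis+
  then have "(vector [\<xi> (k+1), z (k+1) $ 1, z (k+1) $ 2] :: real^3)
                  = M_PD3O *v vector [\<xi> k, z k $ 1, z k $ 2]"
    by (simp add: \<xi>_def vec3_eq_iff)
  moreover have "s k \<in> set_P"
    by (subst line) (simp add: set_P_def)
  ultimately show "s k = \<xi> k *\<^sub>R vector [1, 3] \<and> s k \<in> set_P \<and>
                (vector [\<xi> (k+1), z (k+1) $ 1, z (k+1) $ 2] :: real^3)
                  = M_PD3O *v vector [\<xi> k, z k $ 1, z k $ 2]"
    using line by blast
qed

lemma ex_PD3O_divergent: "\<exists>s x z. ex_PD3O_iterates s x z \<and> \<not> convergent (\<lambda>k. (s k, x k, z k))"
proof -
  obtain l v where l: "l < -1" and "eigenpair M_PD3O l v"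
    using eigenpair_M_PD3O by blast
  then have v: "v \<noteq> 0" "M_PD3O *v v = l *\<^sub>R v" by (auto simp: eigenpair_def)
  \<comment> \<open>The run whose state at index \<open>k\<close> is
    \<open>l ^ k *\<^sub>R v\<close>.\<close>
  define s z where "s = (\<lambda>k. (l ^ k * v $ 1) *\<^sub>R vector [1, 3] :: real^2)"
    and "z = (\<lambda>k. vector [l ^ k * v $ 2, l ^ k * v $ 3] :: real^2)"
  define x where "x = (\<lambda>k. closest_point set_Q (z k))"
  have w: "M_PD3O *v vector [l ^ k * v $ 1, z k $ 1, z k $ 2] = l ^ (k+1) *\<^sub>R v" for k
  proof -
    have "vector [l ^ k * v $ 1, z k $ 1, z k $ 2] = l ^ k *\<^sub>R v"
      by (simp add: z_def vec3_eq_iff)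
    then show ?thesis using v(2) by (simp add: matrix_vector_mult_scaleR)
  qed
  have "ex_PD3O_iterates s x z"
    unfolding ex_PD3O_iterates_def
  proof (intro allI conjI)
    fix k
    note step = PD3O_step[OF refl, where \<xi> = "l ^ k * v $ 1" and z = "z k", unfolded w]
    show "s (k+1) = closest_point set_P ((1 - ex_tau * ex_eta) *\<^sub>R s k
         + ex_eta *\<^sub>R (2 *\<^sub>R x k - z k - ex_tau *\<^sub>R grad ex_f (x k)))"
      unfolding x_def s_def step(1) by simp
    then show "z (k+1) = x k - ex_tau *\<^sub>R grad ex_f (x k) - ex_tau *\<^sub>R s (k+1)"
      using step(2) unfolding x_def s_def by (simp add: z_def)
  qed (simp add: x_def)
  moreover have "\<not> convergent (\<lambda>k. (s k, x k, z k))"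
  proof
    assume conv: "convergent (\<lambda>k. (s k, x k, z k))"
    \<comment> \<open>It is not known which entry of \<open>v\<close> is nonzero, so all three are
      tested: the first through \<open>s\<close>, the others through \<open>z\<close>.\<close>
    have "convergent (\<lambda>k. l ^ k * v $ 1)" "convergent (\<lambda>k. l ^ k * v $ 2)"
      "convergent (\<lambda>k. l ^ k * v $ 3)"
      using convergent_components[OF conv, of 1] convergent_components(2)[OF conv, of 2]
      by (simp_all add: s_def z_def)
    then have "v = 0"
      using not_convergent_power_mult[OF l] by (auto simp: vec3_eq_iff)
    with v(1) show False by simp
  qed
  ultimately show ?thesis by blast
qed

theorem mainTheorem3:
  shows
   "\<comment> \<open>no convergence guarantee for the general problem\<close>
    \<not> (\<forall>(f :: real^2 \<Rightarrow> real) (g :: real^2 \<Rightarrow> ereal) (h :: real^2 \<Rightarrow> ereal) (A :: real^2^2) L \<tau> \<eta>.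
          three_function_problem f g h A L \<and> separated_condition A L \<tau> \<eta> \<longrightarrow>
          (\<forall>s x y. PDDY_iterates f g h A \<tau> \<eta> s x y \<longrightarrow> convergent (\<lambda>k. (s k, x k, y k)))) \<and>
    \<not> (\<forall>(f :: real^2 \<Rightarrow> real) (g :: real^2 \<Rightarrow> ereal) (h :: real^2 \<Rightarrow> ereal) (A :: real^2^2) L \<tau> \<eta>.
          three_function_problem f g h A L \<and> separated_condition A L \<tau> \<eta> \<longrightarrow>
          (\<forall>s x z. PD3O_iterates f g h A \<tau> \<eta> s x z \<longrightarrow> convergent (\<lambda>k. (s k, x k, z k)))) \<and>
    \<comment> \<open>the data of the example\<close>
    conjugate ex_h = indicator_fun set_P \<and>
    (\<forall>x. GDERIV ex_f x :> grad ex_f x) \<and>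
    1-lipschitz_on UNIV (grad ex_f) \<and>
    (spectral_norm ex_A)\<^sup>2 = 1 \<and>
    ex_tau * 1 / 2 = 39/40 \<and> (39/40 :: real) < 1 \<and>
    ex_tau * ex_eta * (spectral_norm ex_A)\<^sup>2 = 13/10 \<and> (13/10 :: real) < 4/3 \<and>
    (\<forall>x. primal_solution ex_f ex_g ex_h ex_A x \<longleftrightarrow> x = 0) \<and>
    saddle_point ex_f ex_g ex_h ex_A 0 0 \<and>
    \<comment> \<open>(a)\<close>
    (\<exists>l v. l < -1 \<and> eigenpair M_PDDY l v) \<and>
    (\<exists>B. eigenbasis M_PDDY B) \<and>
    (\<forall>s x y. ex_PDDY_iterates s x y \<longrightarrow>
       (\<exists>\<xi> \<zeta> :: nat \<Rightarrow> real.
          (\<forall>k\<ge>1. s k = \<xi> k *\<^sub>R vector [1, 3] \<and> s k \<in> set_P \<and>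
                 y k = \<zeta> k *\<^sub>R vector [1, 1] \<and> y k \<in> set_Q \<and>
                 (vector [\<xi> (k+1), \<zeta> (k+1)] :: real^2) = M_PDDY *v vector [\<xi> k, \<zeta> k]) \<and>
          (\<forall>B l v. eigenbasis M_PDDY B \<and> v \<in> B \<and> eigenpair M_PDDY l v \<and> l < -1 \<and>
                   representation B (vector [\<xi> 1, \<zeta> 1]) v \<noteq> 0 \<longrightarrow>
                   \<not> convergent (\<lambda>k. (s k, x k, y k))))) \<and>
    \<comment> \<open>(b)\<close>
    (\<exists>l v. l < -1 \<and> eigenpair M_PD3O l v) \<and>
    (\<forall>s x z. ex_PD3O_iterates s x z \<longrightarrow>
       (\<exists>\<xi> :: nat \<Rightarrow> real.
          \<forall>k\<ge>1. s k = \<xi> k *\<^sub>R vector [1, 3] \<and> s k \<in> set_P \<and>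
                (vector [\<xi> (k+1), z (k+1) $ 1, z (k+1) $ 2] :: real^3)
                  = M_PD3O *v vector [\<xi> k, z k $ 1, z k $ 2])) \<and>
    (\<exists>s x z. ex_PD3O_iterates s x z \<and> \<not> convergent (\<lambda>k. (s k, x k, z k)))"
proof (intro conjI)
  show "\<not> (\<forall>(f :: real^2 \<Rightarrow> real) (g :: real^2 \<Rightarrow> ereal) (h :: real^2 \<Rightarrow> ereal) (A :: real^2^2) L \<tau> \<eta>.
          three_function_problem f g h A L \<and> separated_condition A L \<tau> \<eta> \<longrightarrow>
          (\<forall>s x y. PDDY_iterates f g h A \<tau> \<eta> s x y \<longrightarrow> convergent (\<lambda>k. (s k, x k, y k))))"
    \<comment> \<open>The example is an admissible instance with a divergent run.\<close>
    using three_function_problem_ex separated_condition_ex ex_PDDY_divergent PDDY_iterates_ex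
    by blast
  show "\<not> (\<forall>(f :: real^2 \<Rightarrow> real) (g :: real^2 \<Rightarrow> ereal) (h :: real^2 \<Rightarrow> ereal) (A :: real^2^2) L \<tau> \<eta>.
          three_function_problem f g h A L \<and> separated_condition A L \<tau> \<eta> \<longrightarrow>
          (\<forall>s x z. PD3O_iterates f g h A \<tau> \<eta> s x z \<longrightarrow> convergent (\<lambda>k. (s k, x k, z k))))"
    using three_function_problem_ex separated_condition_ex ex_PD3O_divergent PD3O_iterates_ex
    by blast
  show "\<exists>l v. l < -1 \<and> eigenpair M_PDDY l v"
    using eigenvalue_PDDY eigenpair_M_PDDY by blast
  show "\<forall>s x y. ex_PDDY_iterates s x y \<longrightarrow>
       (\<exists>\<xi> \<zeta> :: nat \<Rightarrow> real.
          (\<forall>k\<ge>1. s k = \<xi> k *\<^sub>R vector [1, 3] \<and> s k \<in> set_P \<and>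
                 y k = \<zeta> k *\<^sub>R vector [1, 1] \<and> y k \<in> set_Q \<and>
                 (vector [\<xi> (k+1), \<zeta> (k+1)] :: real^2) = M_PDDY *v vector [\<xi> k, \<zeta> k]) \<and>
          (\<forall>B l v. eigenbasis M_PDDY B \<and> v \<in> B \<and> eigenpair M_PDDY l v \<and> l < -1 \<and>
                   representation B (vector [\<xi> 1, \<zeta> 1]) v \<noteq> 0 \<longrightarrow>
                   \<not> convergent (\<lambda>k. (s k, x k, y k))))"
  proof (intro allI impI)
    fix s x y :: "nat \<Rightarrow> real^2"
    assume it: "ex_PDDY_iterates s x y"
    show "\<exists>\<xi> \<zeta> :: nat \<Rightarrow> real.
          (\<forall>k\<ge>1. s k = \<xi> k *\<^sub>R vector [1, 3] \<and> s k \<in> set_P \<and>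
                 y k = \<zeta> k *\<^sub>R vector [1, 1] \<and> y k \<in> set_Q \<and>
                 (vector [\<xi> (k+1), \<zeta> (k+1)] :: real^2) = M_PDDY *v vector [\<xi> k, \<zeta> k]) \<and>
          (\<forall>B l v. eigenbasis M_PDDY B \<and> v \<in> B \<and> eigenpair M_PDDY l v \<and> l < -1 \<and>
                   representation B (vector [\<xi> 1, \<zeta> 1]) v \<noteq> 0 \<longrightarrow>
                   \<not> convergent (\<lambda>k. (s k, x k, y k)))"
      \<comment> \<open>Unification with \<open>PDDY_linear\<close> fixes the witnesses as the first
        coordinates of \<open>s\<close> and \<open>y\<close>, which is the form
        \<open>PDDY_divergent\<close> expects.\<close>
      by (intro exI conjI, rule PDDY_linear[OF it]) (use PDDY_divergent[OF it] in blast)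
  qed
  show "\<forall>s x z. ex_PD3O_iterates s x z \<longrightarrow>
       (\<exists>\<xi> :: nat \<Rightarrow> real.
          \<forall>k\<ge>1. s k = \<xi> k *\<^sub>R vector [1, 3] \<and> s k \<in> set_P \<and>
                (vector [\<xi> (k+1), z (k+1) $ 1, z (k+1) $ 2] :: real^3)
                  = M_PD3O *v vector [\<xi> k, z k $ 1, z k $ 2])"
  proof (intro allI impI)
    fix s x z :: "nat \<Rightarrow> real^2"
    assume it: "ex_PD3O_iterates s x z"
    show "\<exists>\<xi> :: nat \<Rightarrow> real.
          \<forall>k\<ge>1. s k = \<xi> k *\<^sub>R vector [1, 3] \<and> s k \<in> set_P \<and>
                (vector [\<xi> (k+1), z (k+1) $ 1, z (k+1) $ 2] :: real^3)
                  = M_PD3O *v vector [\<xi> k, z k $ 1, z k $ 2]"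
      by (rule exI, rule PD3O_linear[OF it])
  qed
qed (use conjugate_ex_h lipschitz_grad_ex_f primal_solution_ex saddle_point_ex
      eigenbasis_M_PDDY eigenpair_M_PD3O ex_PD3O_divergent GDERIV_ex_f in
    \<open>auto simp: grad_ex_f spectral_norm_ex_A ex_tau_def ex_eta_def\<close>)

end
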